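(* Let $\alpha,\beta$ be positive real numbers, let $A\in\mathbb{C}^{n\times n}$, and let $\|\cdot\|$ be a subordinate matrix norm. Let $m$ be a natural number and let $a\in\mathbb{R}^+$ be such that $\Gamma(\alpha k+\beta)\geq a^k$ for all integers $k\geq m$. If $b:=\|A\|/a<1$, then $$R_m(A)\leq \frac{b^{m+1}}{1-b},$$ where $$R_m(A):=\left\|E_{\alpha,\beta}(A)-\sum_{k=0}^{m}\frac{A^{k}}{\Gamma(\alpha k+\beta)}\right\|.$$
   Context: $\Gamma$ denotes the Euler Gamma function. For real $\alpha>0$, $\beta>0$ and a square complex matrix $A\in\mathbb{C}^{n\times n}$, the (two-parameter) matrix Mittag-Leffler function is defined by the convergent power series $$E_{\alpha,\beta}(A)=\sum_{k=0}^{\infty}\frac{A^{k}}{\Gamma(\alpha k+\beta)}.$$ Thus $R_m(A)=\left\|\sum_{k=m+1}^{\infty}\frac{A^{k}}{\Gamma(\alpha k+\beta)}\right\|$ is the truncation error of the Taylor series. A subordinate matrix norm is an operator norm on $\mathbb{C}^{n\times n}$ induced by a vector norm on $\mathbb{C}^n$. *)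

theory Defs
  imports "HOL-Analysis.Analysis"
begin

(* The library's power operation on (_, _) vec is componentwise, hence the
   separate power with respect to the matrix product. *)
primrec matrix_power :: "'a::semiring_1 ^ 'n ^ 'n \<Rightarrow> nat \<Rightarrow> 'a ^ 'n ^ 'n" where
  "matrix_power A 0 = mat 1"
| "matrix_power A (Suc k) = A ** matrix_power A k"

definition vector_norm :: "(complex ^ 'n \<Rightarrow> real) \<Rightarrow> bool" where
  "vector_norm N \<longleftrightarrow>
     (\<forall>x. 0 \<le> N x) \<and>
     (\<forall>x. N x = 0 \<longleftrightarrow> x = 0) \<and>
     (\<forall>c x. N (c *s x) = cmod c * N x) \<and>
     (\<forall>x y. N (x + y) \<le> N x + N y)"

(* The supremum is over a nonempty set (index types are nonempty, so the space
   is nontrivial), which is bounded above if N is a vector norm, all vector norms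
   on a finite-dimensional space being equivalent. *)
definition induced_norm :: "(complex ^ 'n \<Rightarrow> real) \<Rightarrow> complex ^ 'n ^ 'n \<Rightarrow> real" where
  "induced_norm N A = (SUP x\<in>{x. x \<noteq> 0}. N (A *v x) / N x)"

definition subordinate_matrix_norm :: "(complex ^ 'n ^ 'n \<Rightarrow> real) \<Rightarrow> bool" where
  "subordinate_matrix_norm nrm \<longleftrightarrow> (\<exists>N. vector_norm N \<and> nrm = induced_norm N)"

definition mittag_leffler_term ::
  "real \<Rightarrow> real \<Rightarrow> complex ^ 'n ^ 'n \<Rightarrow> nat \<Rightarrow> complex ^ 'n ^ 'n" where
  "mittag_leffler_term \<alpha> \<beta> A k = (1 / Gamma (\<alpha> * real k + \<beta>)) *\<^sub>R matrix_power A k"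

(* Convergence of the series is in the product topology on the entries. *)
definition mittag_leffler :: "real \<Rightarrow> real \<Rightarrow> complex ^ 'n ^ 'n \<Rightarrow> complex ^ 'n ^ 'n" where
  "mittag_leffler \<alpha> \<beta> A = (\<Sum>k. mittag_leffler_term \<alpha> \<beta> A k)"

definition truncation_error ::
  "(complex ^ 'n ^ 'n \<Rightarrow> real) \<Rightarrow> real \<Rightarrow> real \<Rightarrow> nat \<Rightarrow> complex ^ 'n ^ 'n \<Rightarrow> real" where
  "truncation_error nrm \<alpha> \<beta> m A =
     nrm (mittag_leffler \<alpha> \<beta> A - (\<Sum>k=0..m. mittag_leffler_term \<alpha> \<beta> A k))"

end

(* For k >= m the k-th term has induced norm at most b ^ k, so the remainder is dominated
   by a geometric series. Since the series converges entrywise, this needs two facts from the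
   equivalence of N with the Euclidean norm: the induced norm controls the entries, which
   yields convergence, and N is continuous, which carries the bound on N (_ *v x) over to the
   limit. *)
theory Submission
  imports Defs
begin

lemma scaleR_matrix_vector_mult: "(r *\<^sub>R M) *v x = r *\<^sub>R (M *v x)"
  for M :: "complex ^ 'n ^ 'm"
  by (simp add: matrix_vector_mult_def vec_eq_iff scaleR_sum_right)

text \<open>Linearity in the matrix with the vector fixed: this allows an infinite sum of matrices
  to be applied to a vector term by term.\<close>

lemma bounded_linear_matrix_vector_mult_left:
  "bounded_linear (\<lambda>M :: complex ^ 'n ^ 'm. M *v x)"
  by (intro linear_conv_bounded_linear[THEN iffD1] linearI)
    (simp_all add: matrix_vector_mult_add_rdistrib scaleR_matrix_vector_mult)

lemma norm_vec_le_sum: "norm x \<le> (\<Sum>i\<in>UNIV. norm (x $ i))"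
  unfolding norm_vec_def by (rule L2_set_le_sum) simp

context
  fixes N :: "complex ^ 'n \<Rightarrow> real"
  assumes N: "vector_norm N"
begin

lemma vector_norm_nonneg: "0 \<le> N x"
  and vector_norm_eq_0_iff: "N x = 0 \<longleftrightarrow> x = 0"
  and vector_norm_cmult: "N (c *s x) = cmod c * N x"
  and vector_norm_triangle: "N (x + y) \<le> N x + N y"
  using N unfolding vector_norm_def by blast+

lemma vector_norm_pos: "x \<noteq> 0 \<Longrightarrow> 0 < N x"
  using vector_norm_nonneg[of x] vector_norm_eq_0_iff[of x] by linarith

lemma vector_norm_scaleR: "N (r *\<^sub>R x) = \<bar>r\<bar> * N x"
proof -
  have "r *\<^sub>R x = of_real r *s x"
    by (simp add: vec_eq_iff vector_scalar_mult_def) (simp add: scaleR_conv_of_real)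
  then show ?thesis
    by (simp add: vector_norm_cmult)
qed

lemma vector_norm_sum_le: "N (\<Sum>i\<in>I. f i) \<le> (\<Sum>i\<in>I. N (f i))"
proof (induction I rule: infinite_finite_induct)
  case (insert i I)
  then show ?case
    using vector_norm_triangle[of "f i" "sum f I"] by simp
qed (simp_all add: vector_norm_eq_0_iff[THEN iffD2])

text \<open>The easy half of norm equivalence: expand \<open>x\<close> in the standard basis and
  bound each coordinate by the Euclidean norm.\<close>

lemma vector_norm_le_norm: "N x \<le> (\<Sum>i\<in>UNIV. N (axis i 1)) * norm x"
proof -
  have "N x = N (\<Sum>i\<in>UNIV. x $ i *s axis i 1)"
    by (simp add: basis_expansion)
  also have "\<dots> \<le> (\<Sum>i\<in>UNIV. cmod (x $ i) * N (axis i 1))"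
    using vector_norm_sum_le[of "\<lambda>i. x $ i *s axis i 1" UNIV]
    by (simp add: vector_norm_cmult)
  also have "\<dots> \<le> (\<Sum>i\<in>UNIV. norm x * N (axis i 1))"
    by (intro sum_mono mult_right_mono vector_norm_nonneg Finite_Cartesian_Product.norm_nth_le)
  finally show ?thesis
    by (simp add: sum_distrib_left mult.commute)
qed

lemma continuous_on_vector_norm: "continuous_on S N"
proof -
  let ?C = "\<Sum>i\<in>UNIV. N (axis i 1)"
  have "N x - N y \<le> ?C * norm (x - y)" for x y
    using vector_norm_triangle[of "x - y" y] vector_norm_le_norm[of "x - y"] by simp
  \<comment> \<open>The other sign follows by exchanging \<open>x\<close> and
    \<open>y\<close>.\<close>
  then have "\<bar>N x - N y\<bar> \<le> ?C * norm (x - y)" for x y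
    by (smt (verit) norm_minus_commute)
  then have "?C-lipschitz_on S N"
    by (intro lipschitz_onI) (auto simp: dist_norm vector_norm_nonneg intro: sum_nonneg)
  then show ?thesis
    by (rule lipschitz_on_continuous_on)
qed

text \<open>The compactness half of norm equivalence: the continuous \<open>N\<close> attains a
  minimum \<open>N u\<close> on the Euclidean unit sphere, which is positive since \<open>u\<close>
  is nonzero. Homogeneity then yields the constant \<open>1 / N u\<close>.\<close>

lemma norm_le_vector_norm: "\<exists>c>0. \<forall>x. norm x \<le> c * N x"
proof -
  obtain u :: "complex ^ 'n"
    where u: "norm u = 1" and min: "\<And>y. norm y = 1 \<Longrightarrow> N u \<le> N y"
    using continuous_attains_inf[OF compact_sphere _ continuous_on_vector_norm,
        of "0 :: complex ^ 'n" 1]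
    by auto
  have pos: "0 < N u"
    using u by (intro vector_norm_pos) auto
  have "norm x \<le> 1 / N u * N x" for x
  proof (cases "x = 0")
    case False
    then have "N u \<le> N ((1 / norm x) *\<^sub>R x)"
      by (intro min) simp
    then show ?thesis
      using pos False by (simp add: vector_norm_scaleR field_simps)
  qed (simp add: vector_norm_eq_0_iff[THEN iffD2])
  then show ?thesis
    using pos by (intro exI[of _ "1 / N u"]) simp
qed

text \<open>A real supremum is an upper bound only for a set that is bounded above. Here the bound
  comes from passing to the Euclidean norm, in which \<open>M\<close> is a bounded map, and back, at
  the cost of one constant each way.\<close>

lemma bdd_above_induced_norm:
  "bdd_above ((\<lambda>x. N (M *v x) / N x) ` {x. x \<noteq> 0})"
proof -
  let ?C = "\<Sum>i\<in>UNIV. N (axis i 1)"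
  obtain c where c: "0 < c" "\<And>x. norm x \<le> c * N x"
    using norm_le_vector_norm by blast
  obtain B where B: "0 < B" "\<And>x. norm (M *v x) \<le> norm x * B"
    using bounded_linear.pos_bounded[OF matrix_vector_mul_bounded_linear] by blast
  have C: "0 \<le> ?C"
    by (simp add: sum_nonneg vector_norm_nonneg)
  have "N (M *v x) \<le> ?C * (c * B) * N x" for x
  proof -
    have "N (M *v x) \<le> ?C * norm (M *v x)"
      by (rule vector_norm_le_norm)
    also have "\<dots> \<le> ?C * (c * N x * B)"
      using B C c(2)[of x] by (intro mult_left_mono order_trans[OF B(2)] mult_right_mono) auto
    finally show ?thesis
      by (simp add: mult_ac)
  qed
  then show ?thesis
    by (intro bdd_aboveI2[where M = "?C * (c * B)"])
      (simp add: vector_norm_pos divide_le_eq)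
qed

lemma vector_norm_matrix_vector_mult_le: "N (M *v x) \<le> induced_norm N M * N x"
proof (cases "x = 0")
  case False
  then have "N (M *v x) / N x \<le> induced_norm N M"
    unfolding induced_norm_def by (intro cSUP_upper bdd_above_induced_norm) simp
  then show ?thesis
    using False by (simp add: vector_norm_pos divide_le_eq)
qed (simp add: vector_norm_eq_0_iff[THEN iffD2])

lemma induced_norm_le:
  assumes "\<And>x. N (M *v x) \<le> K * N x"
  shows "induced_norm N M \<le> K"
  unfolding induced_norm_def
proof (rule cSUP_least)
  \<comment> \<open>\<open>undefined\<close> stands for an arbitrary index; any basis vector shows
    that the supremum is over a nonempty set.\<close>
  have "axis undefined 1 \<noteq> (0 :: complex ^ 'n)"
    by simp
  then show "{x :: complex ^ 'n. x \<noteq> 0} \<noteq> {}"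
    by blast
qed (use assms in \<open>simp add: vector_norm_pos divide_le_eq\<close>)

lemma induced_norm_nonneg: "0 \<le> induced_norm N M"
proof -
  let ?x = "axis undefined 1 :: complex ^ 'n"
  have "0 \<le> induced_norm N M * N ?x"
    using vector_norm_matrix_vector_mult_le vector_norm_nonneg by (rule order_trans[rotated])
  then show ?thesis
    using vector_norm_pos[of ?x] by (simp add: zero_le_mult_iff)
qed

text \<open>Submultiplicativity in action form: each factor \<open>M\<close> costs one factor
  \<open>induced_norm N M\<close>.\<close>

lemma vector_norm_matrix_power_le: "N (matrix_power M k *v x) \<le> induced_norm N M ^ k * N x"
proof (induction k)
  case (Suc k)
  have "N (matrix_power M (Suc k) *v x) \<le> induced_norm N M * N (matrix_power M k *v x)"
    using vector_norm_matrix_vector_mult_le[of M "matrix_power M k *v x"]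
    by (simp add: matrix_vector_mul_assoc)
  also have "\<dots> \<le> induced_norm N M * (induced_norm N M ^ k * N x)"
    by (intro mult_left_mono Suc.IH induced_norm_nonneg)
  finally show ?case
    by (simp add: mult_ac)
qed simp

text \<open>Entry \<open>(i, j)\<close> is coordinate \<open>i\<close> of the image of basis vector
  \<open>j\<close>, so the induced norm controls it. This turns bounds on the induced norm into
  bounds on the library norm, where comparison tests apply.\<close>

lemma norm_matrix_le_induced_norm: "\<exists>K. \<forall>M. norm M \<le> K * induced_norm N M"
proof -
  obtain c where c: "0 < c" "\<And>x. norm x \<le> c * N x"
    using norm_le_vector_norm by blast
  have "norm M \<le> (\<Sum>i\<in>(UNIV :: 'n set). \<Sum>j\<in>UNIV. c * N (axis j 1)) * induced_norm N M"
    for M :: "complex ^ 'n ^ 'n"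
  proof -
    have entry: "norm (M $ i $ j) \<le> c * N (axis j 1) * induced_norm N M" for i j
    proof -
      have "norm (M $ i $ j) = norm ((M *v axis j 1) $ i)"
        by (simp add: matrix_vector_mult_def axis_def if_distrib cong: if_cong)
      also have "\<dots> \<le> c * N (M *v axis j 1)"
        by (rule order_trans[OF Finite_Cartesian_Product.norm_nth_le c(2)])
      also have "\<dots> \<le> c * (induced_norm N M * N (axis j 1))"
        using c(1) by (simp add: vector_norm_matrix_vector_mult_le)
      finally show ?thesis
        by (simp add: mult_ac)
    qed
    have "norm M \<le> (\<Sum>i\<in>UNIV. norm (M $ i))"
      by (rule norm_vec_le_sum)
    also have "\<dots> \<le> (\<Sum>i\<in>UNIV. \<Sum>j\<in>UNIV. norm (M $ i $ j))"
      by (intro sum_mono norm_vec_le_sum)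
    also have "\<dots> \<le> (\<Sum>i\<in>(UNIV :: 'n set). \<Sum>j\<in>UNIV. c * N (axis j 1) * induced_norm N M)"
      by (intro sum_mono entry)
    finally show ?thesis
      by (simp only: sum_distrib_right)
  qed
  then show ?thesis
    by blast
qed

text \<open>The hypothesis bounds the action on vectors because in that form it passes to partial
  sums by the triangle inequality, and to the limit by continuity of \<open>N\<close>.\<close>

lemma induced_norm_suminf_le:
  assumes le: "\<And>k x. N (f k *v x) \<le> g k * N x" and g: "summable g"
  shows "summable f" and "induced_norm N (\<Sum>k. f k) \<le> (\<Sum>k. g k)"
proof -
  obtain K where K: "\<And>M. norm M \<le> K * induced_norm N M"
    using norm_matrix_le_induced_norm by blast
  \<comment> \<open>The sign of \<open>K\<close> is not known, hence the absolute value.\<close>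
  have "norm (f k) \<le> \<bar>K\<bar> * g k" for k
  proof -
    have "norm (f k) \<le> \<bar>K\<bar> * induced_norm N (f k)"
      using K[of "f k"] mult_right_mono[OF abs_ge_self[of K] induced_norm_nonneg[of "f k"]]
      by linarith
    also have "\<dots> \<le> \<bar>K\<bar> * g k"
      by (intro mult_left_mono induced_norm_le le) simp
    finally show ?thesis .
  qed
  then show f: "summable f"
    by (rule summable_comparison_test'[where N = 0, OF summable_mult[OF g]])
  \<comment> \<open>Each \<open>g k\<close> dominates an induced norm; nonnegativity puts the
    partial sums of \<open>g\<close> below its total.\<close>
  have g_nonneg: "0 \<le> g k" for k
    using induced_norm_nonneg induced_norm_le[OF le] by (rule order_trans)
  show "induced_norm N (\<Sum>k. f k) \<le> (\<Sum>k. g k)"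
  proof (rule induced_norm_le)
    fix x
    have "(\<lambda>k. f k *v x) sums ((\<Sum>k. f k) *v x)"
      by (intro bounded_linear.sums[OF bounded_linear_matrix_vector_mult_left]
          summable_sums f)
    then have "(\<lambda>n. N (\<Sum>k<n. f k *v x)) \<longlonglongrightarrow> N ((\<Sum>k. f k) *v x)"
      unfolding sums_def
      by (intro continuous_on_tendsto_compose[OF continuous_on_vector_norm[of UNIV]]) auto
    moreover have "N (\<Sum>k<n. f k *v x) \<le> (\<Sum>k. g k) * N x" for n
    proof -
      have "N (\<Sum>k<n. f k *v x) \<le> (\<Sum>k<n. g k) * N x"
        unfolding sum_distrib_right
        by (rule order_trans[OF vector_norm_sum_le sum_mono]) (rule le)
      also have "\<dots> \<le> (\<Sum>k. g k) * N x"
        by (intro mult_right_mono sum_le_suminf g g_nonneg vector_norm_nonneg) simp_all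
      finally show ?thesis .
    qed
    ultimately show "N ((\<Sum>k. f k) *v x) \<le> (\<Sum>k. g k) * N x"
      by (intro LIMSEQ_le_const2) auto
  qed
qed

end

theorem proposition3p3:
  fixes \<alpha> \<beta> a b :: real
    and m :: nat
    and A :: "complex ^ 'n ^ 'n"
    and nrm :: "complex ^ 'n ^ 'n \<Rightarrow> real"
  assumes "\<alpha> > 0" and "\<beta> > 0"
    and "subordinate_matrix_norm nrm"
    and "a > 0"
    and "\<And>k::nat. k \<ge> m \<Longrightarrow> Gamma (\<alpha> * real k + \<beta>) \<ge> a ^ k"
    and "b = nrm A / a" and "b < 1"
  shows "truncation_error nrm \<alpha> \<beta> m A \<le> b ^ (m + 1) / (1 - b)"
proof -
  obtain N where N: "vector_norm N" and nrm: "nrm = induced_norm N"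
    using assms(3) unfolding subordinate_matrix_norm_def by blast
  let ?t = "mittag_leffler_term \<alpha> \<beta> A"
  have b: "0 \<le> b"
    using induced_norm_nonneg[OF N, of A] assms by (simp add: nrm)
  have term_le: "N (?t k *v x) \<le> b ^ k * N x" if "m \<le> k" for k x
  proof -
    \<comment> \<open>The positive lower bound makes the Gamma value positive, which removes the
      absolute value that scaling introduces.\<close>
    have G: "0 < a ^ k" "a ^ k \<le> Gamma (\<alpha> * real k + \<beta>)"
      using assms that by simp_all
    have "N (?t k *v x) = N (matrix_power A k *v x) / Gamma (\<alpha> * real k + \<beta>)"
      using G by (simp add: mittag_leffler_term_def scaleR_matrix_vector_mult
          vector_norm_scaleR[OF N])
    also have "\<dots> \<le> (nrm A ^ k * N x) / a ^ k"
      unfolding nrm using G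
      by (intro frac_le vector_norm_matrix_power_le vector_norm_nonneg N
          mult_nonneg_nonneg zero_le_power induced_norm_nonneg)
    finally show ?thesis
      by (simp add: \<open>b = nrm A / a\<close> power_divide)
  qed
  have geo: "(\<lambda>k. b ^ (k + (m + 1))) sums (b ^ (m + 1) / (1 - b))"
    using sums_mult[OF geometric_sums[of b], of "b ^ (m + 1)"] b \<open>b < 1\<close>
    by (simp add: power_add mult_ac)
  \<comment> \<open>The condition \<open>m \<le> k + (m + 1)\<close> from \<open>term_le\<close>
    stays as a trivially true premise of \<open>tail\<close>.\<close>
  note tail = induced_norm_suminf_le[OF N, of "\<lambda>k. ?t (k + (m + 1))",
      OF term_le sums_summable[OF geo]]
  \<comment> \<open>The sum up to \<open>m\<close> has \<open>m + 1\<close> terms, hence the shift.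
    Summability is known for the tail and passes to the whole series by
    \<open>summable_iff_shift\<close>.\<close>
  have "mittag_leffler \<alpha> \<beta> A - (\<Sum>k=0..m. ?t k) = (\<Sum>k. ?t (k + (m + 1)))"
    unfolding mittag_leffler_def using tail(1)
    by (subst suminf_minus_initial_segment)
      (simp_all only: summable_iff_shift atLeast0AtMost lessThan_Suc_atMost Suc_eq_plus1[symmetric])
  then show ?thesis
    using tail(2) unfolding truncation_error_def nrm sums_unique[OF geo] by simp
qed

end
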